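(* Let $H$ be a complex Hilbert space with $\dim H\ge 3$, and let $[0,I]$ be the set of all effects on $H$. Let $\phi:[0,I]\to[0,I]$ be a bijective function satisfying \[ \phi(ABA)=\phi(A)\phi(B)\phi(A)\qquad\text{for all } A,B\in[0,I]. \] Then there is an operator $U$ on $H$ which is either unitary or antiunitary such that \[ \phi(A)=UAU^*\qquad\text{for all } A\in[0,I]. \]
   Context: $B(H)$ denotes the algebra of all bounded linear operators on $H$, and $I$ is the identity operator on $H$. The operator interval $[0,I]$ is the set of all positive operators $A\in B(H)$ with $A\le I$, where $\le$ is the usual order on self-adjoint operators; its elements are called effects. If $A,B\in[0,I]$ then $ABA\in[0,I]$. The space $H$ may be finite- or infinite-dimensional. An antiunitary operator $U$ on $H$ is a conjugate-linear bijection with $\langle Ux,Uy\rangle=\overline{\langle x,y\rangle}$ for all $x,y\in H$; its adjoint is $U^*=U^{-1}$. *)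

theory Defs
  imports "HOL-Analysis.Analysis"
begin

class scaleC =
  fixes scaleC :: "complex \<Rightarrow> 'a \<Rightarrow> 'a"  (infixr \<open>*\<^sub>C\<close> 75)

text \<open>The inner product is linear in its first argument. Completeness and the norm topology come
  from \<^class>\<open>banach\<close>; the norm is the one given by the inner product.\<close>

class complex_hilbert = scaleC + banach +
  fixes cinner :: "'a \<Rightarrow> 'a \<Rightarrow> complex"
  assumes scaleC_add_right: "a *\<^sub>C (x + y) = a *\<^sub>C x + a *\<^sub>C y"
    and scaleC_add_left: "(a + b) *\<^sub>C x = a *\<^sub>C x + b *\<^sub>C x"
    and scaleC_scaleC: "a *\<^sub>C b *\<^sub>C x = (a * b) *\<^sub>C x"
    and scaleC_one: "1 *\<^sub>C x = x"
    and scaleR_scaleC: "r *\<^sub>R x = complex_of_real r *\<^sub>C x"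
    and cinner_commute: "cinner x y = cnj (cinner y x)"
    and cinner_add_left: "cinner (x + y) z = cinner x z + cinner y z"
    and cinner_scaleC_left: "cinner (a *\<^sub>C x) y = a * cinner x y"
    and cinner_ge_zero: "0 \<le> Re (cinner x x)"
    and cinner_eq_zero_iff: "cinner x x = 0 \<longleftrightarrow> x = 0"
    and norm_eq_sqrt_cinner: "norm x = sqrt (Re (cinner x x))"

interpretation complex_vector: vector_space "scaleC :: complex \<Rightarrow> 'a \<Rightarrow> 'a::complex_hilbert"
  by unfold_locales
    (simp_all add: scaleC_add_right scaleC_add_left scaleC_scaleC scaleC_one)

lemma cinner_add_right: "cinner x (y + z) = cinner x y + cinner (x::'a::complex_hilbert) z"
  by (metis cinner_add_left cinner_commute complex_cnj_add)

lemma cinner_scaleC_right: "cinner x (a *\<^sub>C y) = cnj a * cinner (x::'a::complex_hilbert) y"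
  by (metis cinner_commute cinner_scaleC_left complex_cnj_mult)

lemma cinner_diff_right: "cinner x (y - z) = cinner x y - cinner (x::'a::complex_hilbert) z"
  by (metis add_diff_cancel_right' cinner_add_right diff_add_cancel)

lemma cinner_eqI:
  fixes y z :: "'a::complex_hilbert"
  assumes "\<And>x. cinner x y = cinner x z"
  shows "y = z"
  by (metis assms cinner_diff_right cinner_eq_zero_iff right_minus_eq)

text \<open>The complex dimension of the whole space is at least \<open>n\<close>; infinite-dimensional spaces
  qualify for every \<open>n\<close>.\<close>

definition cdim_at_least :: "'a::complex_hilbert itself \<Rightarrow> nat \<Rightarrow> bool" where
  "cdim_at_least _ n \<longleftrightarrow>
    (\<exists>B :: 'a set. finite B \<and> card B = n \<and> \<not> complex_vector.dependent B)"

lemma cdim_at_least_iff_dim: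
  "cdim_at_least TYPE('a::complex_hilbert) n \<longleftrightarrow>
    ((\<exists>B :: 'a set. finite B \<and> complex_vector.span B = UNIV) \<longrightarrow>
      n \<le> complex_vector.dim (UNIV :: 'a set))"
proof -
  obtain C :: "'a set" where C: "\<not> complex_vector.dependent C" "complex_vector.span C = UNIV"
    using complex_vector.basis_exists[of UNIV] by (metis top.extremum_uniqueI)
  have dimC: "complex_vector.dim (UNIV :: 'a set) = card C"
    using complex_vector.dim_eq_card[of C UNIV] C by simp
  have finC: "finite C" if "finite B" "complex_vector.span B = UNIV" for B :: "'a set"
    using complex_vector.independent_span_bound[of B C] that C by auto
  show ?thesis
  proof
    assume "cdim_at_least TYPE('a) n"
    then obtain A :: "'a set" where A: "finite A" "card A = n" "\<not> complex_vector.dependent A"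
      unfolding cdim_at_least_def by blast
    show "(\<exists>B :: 'a set. finite B \<and> complex_vector.span B = UNIV) \<longrightarrow>
        n \<le> complex_vector.dim (UNIV :: 'a set)"
      using complex_vector.independent_span_bound[of C A] A C finC dimC by auto
  next
    assume *: "(\<exists>B :: 'a set. finite B \<and> complex_vector.span B = UNIV) \<longrightarrow>
        n \<le> complex_vector.dim (UNIV :: 'a set)"
    have "\<exists>A \<subseteq> C. finite A \<and> card A = n"
    proof (cases "finite C")
      case True
      then have "n \<le> card C" using * C dimC by auto
      then show ?thesis by (metis True finite_subset obtain_subset_with_card_n)
    next
      case False
      then show ?thesis using infinite_arbitrarily_large by blast
    qed
    then show "cdim_at_least TYPE('a) n"
      unfolding cdim_at_least_def using C(1) complex_vector.dependent_mono by blast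
  qed
qed

definition bounded_clinear :: "('a::complex_hilbert \<Rightarrow> 'a) \<Rightarrow> bool" where
  "bounded_clinear A \<longleftrightarrow> bounded_linear A \<and> (\<forall>c x. A (c *\<^sub>C x) = c *\<^sub>C A x)"

definition selfadjoint_op :: "('a::complex_hilbert \<Rightarrow> 'a) \<Rightarrow> bool" where
  "selfadjoint_op A \<longleftrightarrow> bounded_clinear A \<and> (\<forall>x y. cinner (A x) y = cinner x (A y))"

text \<open>The usual order; meant for self-adjoint operators, where both inner products are real.\<close>

definition op_le :: "('a::complex_hilbert \<Rightarrow> 'a) \<Rightarrow> ('a \<Rightarrow> 'a) \<Rightarrow> bool" where
  "op_le A B \<longleftrightarrow> (\<forall>x. Re (cinner (A x) x) \<le> Re (cinner (B x) x))"

definition effects :: "('a::complex_hilbert \<Rightarrow> 'a) set" where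
  "effects = {A. selfadjoint_op A \<and> op_le (\<lambda>x. 0) A \<and> op_le A id}"

text \<open>Meant for bounded complex-linear operators, where the adjoint exists and is unique.\<close>

definition cadjoint :: "('a::complex_hilbert \<Rightarrow> 'a) \<Rightarrow> 'a \<Rightarrow> 'a" where
  "cadjoint T = (SOME S. \<forall>x y. cinner (T x) y = cinner x (S y))"

lemma cadjoint_eqI:
  assumes "\<And>x y. cinner (T x) y = cinner x (S y)"
  shows "cadjoint T = S"
proof -
  have "\<forall>x y. cinner (T x) y = cinner x (cadjoint T y)"
    unfolding cadjoint_def by (rule someI[of _ S]) (use assms in blast)
  then show ?thesis
    by (intro ext cinner_eqI) (metis assms)
qed

definition unitary_op :: "('a::complex_hilbert \<Rightarrow> 'a) \<Rightarrow> bool" where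
  "unitary_op U \<longleftrightarrow> bij U \<and> bounded_clinear U \<and> (\<forall>x y. cinner (U x) (U y) = cinner x y)"

lemma unitary_op_cadjoint: "unitary_op U \<Longrightarrow> cadjoint U = inv U"
  by (rule cadjoint_eqI) (metis bij_inv_eq_iff unitary_op_def)

definition antiunitary_op :: "('a::complex_hilbert \<Rightarrow> 'a) \<Rightarrow> bool" where
  "antiunitary_op U \<longleftrightarrow> bij U \<and> (\<forall>x y. U (x + y) = U x + U y) \<and>
    (\<forall>c x. U (c *\<^sub>C x) = cnj c *\<^sub>C U x) \<and>
    (\<forall>x y. cinner (U x) (U y) = cnj (cinner x y))"

text \<open>The adjoint \<open>U\<^sup>*\<close> of an antiunitary \<open>U\<close> is \<^term>\<open>inv U\<close>.\<close>

lemma antiunitary_op_adjoint: "antiunitary_op U \<Longrightarrow> cinner (U x) y = cnj (cinner x (inv U y))"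
  by (metis antiunitary_op_def bij_inv_eq_iff)

end

theory Submission
  imports Defs
begin

text \<open>Write \<open>P\<^sub>x\<close> for the projection \<open>rank1 x\<close> onto the ray of a unit vector \<open>x\<close>. Since \<open>\<phi>(I) =
  I\<close>, taking \<open>B = I\<close> shows that \<open>\<phi>\<close> preserves squares, hence idempotents; the rank-one
  projections are the minimal idempotents, so \<open>\<phi>\<close> permutes the rays: \<open>\<phi>(P\<^sub>x) = P\<^bsub>x'\<^esub>\<close>
  (\<open>image_rank1\<close>).

  The main point is that the quadratic forms are preserved: \<open>\<langle>\<phi>(A) x', x'\<rangle> = \<langle>A x, x\<rangle>\<close> for every
  effect \<open>A\<close> (\<open>image_form_eq\<close>). Since \<open>P\<^sub>x A P\<^sub>x = \<langle>A x, x\<rangle> P\<^sub>x\<close>, the left side is a function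
  \<open>f\<close> of \<open>\<langle>A x, x\<rangle>\<close> alone. For \<open>A = P\<^sub>q\<close> with \<open>q\<close> in the span of an orthonormal triple,
  Parseval's identity on both sides gives \<open>f(a) + f(b) + f(c) = 1\<close> whenever \<open>a + b + c = 1\<close>.
  This is where three dimensions enter: the equation makes \<open>f\<close> additive, and a bounded additive
  function with \<open>f(1) = 1\<close> is the identity.

  For \<open>A = P\<^sub>y\<close> this says that transition probabilities \<open>\<bar>\<langle>x, y\<rangle>\<bar>\<^sup>2\<close> are preserved, which is the
  situation of Wigner's theorem. The effects yield one more invariant, the real part of \<open>\<langle>x, y\<rangle>
  \<langle>y, z\<rangle> \<langle>z, x\<rangle>\<close> (\<open>ray_image_cycle\<close>), and it makes the proof of Wigner's theorem short: in the
  affine coordinate \<open>z \<mapsto> e + z\<close> around a ray, the correspondence preserves the real inner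
  product, so it is real-linear, and it either commutes or anticommutes with multiplication by
  \<open>\<i>\<close>. The resulting unitary or antiunitary \<open>U\<close> satisfies \<open>\<langle>\<phi>(A) U x, U x\<rangle> = \<langle>A x, x\<rangle>\<close>, and
  polarization finishes the proof.\<close>

section \<open>Complex inner products\<close>

lemma cinner_zero_left [simp]: "cinner 0 (y::'a::complex_hilbert) = 0"
  using cinner_add_left[of 0 0 y] by simp

lemma cinner_zero_right [simp]: "cinner (y::'a::complex_hilbert) 0 = 0"
  using cinner_add_right[of y 0 0] by simp

lemma cinner_diff_left: "cinner (x - y) z = cinner x z - cinner (y::'a::complex_hilbert) z"
  by (metis add_diff_cancel_right' cinner_add_left diff_add_cancel)

lemmas cinner_expand = cinner_add_left cinner_add_right cinner_diff_left cinner_diff_right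
  cinner_scaleC_left cinner_scaleC_right

lemma cinner_self: "cinner x x = complex_of_real ((norm (x::'a::complex_hilbert))\<^sup>2)"
proof -
  have "Im (cinner x x) = 0"
    using cinner_commute[of x x] by (simp add: complex_eq_iff)
  moreover have "(norm x)\<^sup>2 = Re (cinner x x)"
    using cinner_ge_zero by (simp add: norm_eq_sqrt_cinner)
  ultimately show ?thesis by (simp add: complex_eq_iff)
qed

lemma Re_cinner_self: "Re (cinner x x) = (norm (x::'a::complex_hilbert))\<^sup>2"
  by (simp add: cinner_self)

lemma Re_cinner_commute: "Re (cinner x y) = Re (cinner (y::'a::complex_hilbert) x)"
  by (metis cinner_commute cnj.sel(1))

lemma norm_scaleC: "norm (c *\<^sub>C x) = cmod c * norm (x::'a::complex_hilbert)"
proof -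
  have "complex_of_real ((norm (c *\<^sub>C x))\<^sup>2) = complex_of_real ((cmod c * norm x)\<^sup>2)"
    by (simp only: cinner_self[symmetric] cinner_expand)
      (simp add: cinner_self power_mult_distrib flip: mult.assoc, simp add: complex_norm_square
        flip: of_real_power)
  then have "(norm (c *\<^sub>C x))\<^sup>2 = (cmod c * norm x)\<^sup>2"
    using of_real_eq_iff by blast
  then show ?thesis by simp
qed

lemma cmod_cinner_commute: "cmod (cinner x y) = cmod (cinner (y::'a::complex_hilbert) x)"
  by (metis cinner_commute complex_mod_cnj)

lemma normalized:
  assumes "x \<noteq> (0::'a::complex_hilbert)"
  shows "norm (complex_of_real (1 / norm x) *\<^sub>C x) = 1"
  using assms by (simp add: norm_scaleC norm_divide)

lemma norm_diff_square:
  "(norm (x - y))\<^sup>2 = (norm x)\<^sup>2 + (norm y)\<^sup>2 - 2 * Re (cinner x (y::'a::complex_hilbert))"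
  using Re_cinner_commute[of y x] by (simp add: Re_cinner_self[symmetric] cinner_expand)

lemma norm_add_orthogonal_square:
  assumes "cinner x (y::'a::complex_hilbert) = 0"
  shows "(norm (x + y))\<^sup>2 = (norm x)\<^sup>2 + (norm y)\<^sup>2"
  using assms cinner_commute[of y x] by (simp add: Re_cinner_self[symmetric] cinner_expand)

text \<open>Unitary and antiunitary operators alike are real-linear and preserve the real part of the
  inner product. Arguments that treat both kinds at once use only this part, and it separates
  points.\<close>

lemma Re_cinner_eqI:
  fixes x y :: "'a::complex_hilbert"
  assumes "\<And>z. Re (cinner x z) = Re (cinner y z)"
  shows "x = y"
proof -
  have "(norm (x - y))\<^sup>2 = 0"
    using assms[of "x - y"] by (simp add: Re_cinner_self[symmetric] cinner_diff_left)
  then show ?thesis by simp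
qed

text \<open>Three dimensions leave room to extend every unit vector to an orthonormal triple: fewer
  than three vectors cannot span, and a vector outside the span has a nonzero component
  orthogonal to it.\<close>

lemma exists_unit_orthogonal:
  fixes x y :: "'a::complex_hilbert"
  assumes dim: "cdim_at_least TYPE('a) 3"
    and x: "norm x = 1" and y: "norm y = 1" and xy: "x = y \<or> cinner x y = 0"
  shows "\<exists>z. norm z = 1 \<and> cinner x z = 0 \<and> cinner y z = 0"
proof -
  obtain B :: "'a set" where B: "finite B" "card B = 3" "\<not> complex_vector.dependent B"
    using dim unfolding cdim_at_least_def by blast
  have "complex_vector.span {x, y} \<noteq> UNIV"
  proof
    assume "complex_vector.span {x, y} = UNIV"
    then have "card B \<le> card {x, y}"
      using complex_vector.independent_span_bound[of "{x, y}" B] B by auto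
    also have "\<dots> \<le> 2" by (simp add: card_insert_if)
    finally show False using B by simp
  qed
  then obtain w where w: "w \<notin> complex_vector.span {x, y}" by blast
  \<comment> \<open>If the two given vectors coincide, only one component may be subtracted.\<close>
  define r where "r = (if x = y then w - cinner w x *\<^sub>C x
    else w - (cinner w x *\<^sub>C x + cinner w y *\<^sub>C y))"
  have yx: "cinner y x = 0" if "x \<noteq> y" using that xy cinner_commute[of y x] by simp
  have "cinner r x = 0" "cinner r y = 0"
    using x y xy yx by (auto simp: r_def cinner_expand cinner_self)
  moreover have "r \<noteq> 0"
  proof
    assume "r = 0"
    then have "w = cinner w x *\<^sub>C x \<or> w = cinner w x *\<^sub>C x + cinner w y *\<^sub>C y"
      by (auto simp: r_def split: if_splits)
    then show False
      using w by (metis complex_vector.span_add complex_vector.span_base complex_vector.span_scale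
          insertI1 insertI2)
  qed
  ultimately have "norm (complex_of_real (1 / norm r) *\<^sub>C r) = 1"
    "cinner x (complex_of_real (1 / norm r) *\<^sub>C r) = 0"
    "cinner y (complex_of_real (1 / norm r) *\<^sub>C r) = 0"
    using normalized[of r] cinner_commute[of x r] cinner_commute[of y r]
    by (auto simp: cinner_scaleC_right)
  then show ?thesis by blast
qed

lemma exists_unit_vector:
  assumes "cdim_at_least TYPE('a::complex_hilbert) 3"
  shows "\<exists>e::'a. norm e = 1"
proof -
  obtain B :: "'a set" where B: "card B = 3" using assms unfolding cdim_at_least_def by blast
  have "B \<noteq> {}" "B \<noteq> {0}" using B by auto
  then obtain b where "b \<in> B" "b \<noteq> 0" by blast
  then show ?thesis using normalized by blast
qed

section \<open>Effects\<close>

lemma effectD: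
  assumes "A \<in> effects"
  shows "A (x + y) = A x + A y" "A (c *\<^sub>C x) = c *\<^sub>C A x" "A 0 = 0"
    "cinner (A x) y = cinner x (A y)" "0 \<le> Re (cinner (A x) x)"
    "Re (cinner (A x) x) \<le> (norm x)\<^sup>2"
proof -
  have "bounded_linear A" using assms
    by (simp add: effects_def selfadjoint_op_def bounded_clinear_def)
  then show "A (x + y) = A x + A y" "A 0 = 0"
    using linear_simps(1,3) by blast+
  show "A (c *\<^sub>C x) = c *\<^sub>C A x" "cinner (A x) y = cinner x (A y)" "0 \<le> Re (cinner (A x) x)"
    "Re (cinner (A x) x) \<le> (norm x)\<^sup>2"
    using assms
    by (auto simp: effects_def selfadjoint_op_def bounded_clinear_def op_le_def Re_cinner_self)
qed

text \<open>From \<open>A - A\<^sup>2 = A (I - A)\<^sup>2 + (I - A) A\<^sup>2\<close>, where both summands are positive. Together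
  with \<open>A \<le> I\<close> this bounds \<open>A\<close> by \<open>1\<close>, so boundedness never has to be checked separately.\<close>

lemma norm_square_le_form:
  fixes A :: "'a::complex_hilbert \<Rightarrow> 'a"
  assumes add: "\<And>x y. A (x + y) = A x + A y"
    and sym: "\<And>x y. cinner (A x) y = cinner x (A y)"
    and pos: "\<And>x. 0 \<le> Re (cinner (A x) x)"
    and le: "\<And>x. Re (cinner (A x) x) \<le> (norm x)\<^sup>2"
  shows "(norm (A x))\<^sup>2 \<le> Re (cinner (A x) x)"
proof -
  have diff: "A (x - A x) = A x - A (A x)"
    using add[of "x - A x" "A x"] by (simp add: algebra_simps)
  have "0 \<le> Re (cinner (A (x - A x)) (x - A x)) + ((norm (A x))\<^sup>2 - Re (cinner (A (A x)) (A x)))"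
    using pos le by simp
  also have "\<dots> = Re (cinner (A x) x) - (norm (A x))\<^sup>2"
    using sym[of "A x" x] by (simp add: diff cinner_expand Re_cinner_self)
  finally show ?thesis by simp
qed

lemma effectI:
  fixes A :: "'a::complex_hilbert \<Rightarrow> 'a"
  assumes add: "\<And>x y. A (x + y) = A x + A y"
    and scale: "\<And>c x. A (c *\<^sub>C x) = c *\<^sub>C A x"
    and sym: "\<And>x y. cinner (A x) y = cinner x (A y)"
    and pos: "\<And>x. 0 \<le> Re (cinner (A x) x)"
    and le: "\<And>x. Re (cinner (A x) x) \<le> (norm x)\<^sup>2"
  shows "A \<in> effects"
proof -
  have "norm (A x) \<le> norm x * 1" for x
    using power2_le_imp_le[OF order_trans[OF norm_square_le_form[OF add sym pos le] le]] by simp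
  then have "bounded_linear A"
    by (intro bounded_linear_intro[of A 1]) (simp_all add: add scaleR_scaleC scale)
  then show ?thesis
    using assms
    by (auto simp: effects_def selfadjoint_op_def bounded_clinear_def op_le_def Re_cinner_self)
qed

lemma effect_norm_le: "A \<in> effects \<Longrightarrow> norm (A x) \<le> norm x"
  using norm_square_le_form[of A x] effectD(1,4,5,6)[of A]
  by (meson norm_ge_zero order_trans power2_le_imp_le)

lemma effect_form_real: "A \<in> effects \<Longrightarrow> cinner (A x) x = complex_of_real (Re (cinner (A x) x))"
  by (metis cinner_commute effectD(4) Reals_cnj_iff of_real_Re)

lemma id_effect: "id \<in> effects"
  by (rule effectI) (simp_all add: Re_cinner_self)

lemma zero_effect: "(\<lambda>v. 0) \<in> effects"
  by (rule effectI) simp_all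

lemma scalar_effect:
  "0 \<le> t \<Longrightarrow> t \<le> 1 \<Longrightarrow> (\<lambda>v. complex_of_real t *\<^sub>C v) \<in> effects"
  by (rule effectI)
    (simp_all add: scaleC_add_right cinner_expand mult.commute Re_cinner_self
      mult_left_le_one_le)

lemma conjugate_effect:
  assumes A: "A \<in> effects" and B: "B \<in> effects"
  shows "A \<circ> B \<circ> A \<in> effects"
proof (rule effectI)
  fix x
  have "Re (cinner (B (A x)) (A x)) \<le> (norm (A x))\<^sup>2" by (rule effectD(6)[OF B])
  also have "\<dots> \<le> (norm x)\<^sup>2" using effect_norm_le[OF A] by (simp add: power_mono)
  finally show "Re (cinner ((A \<circ> B \<circ> A) x) x) \<le> (norm x)\<^sup>2" by (simp add: effectD(4)[OF A])
  show "0 \<le> Re (cinner ((A \<circ> B \<circ> A) x) x)"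
    using effectD(5)[OF B, of "A x"] by (simp add: effectD(4)[OF A])
qed (simp_all add: effectD[OF A] effectD[OF B])

lemma midpoint_effect:
  assumes A: "A \<in> effects" and B: "B \<in> effects"
  shows "(\<lambda>v. (1/2) *\<^sub>C (A v + B v)) \<in> effects"
proof (rule effectI)
  fix x
  show "0 \<le> Re (cinner ((1/2) *\<^sub>C (A x + B x)) x)"
    "Re (cinner ((1/2) *\<^sub>C (A x + B x)) x) \<le> (norm x)\<^sup>2"
    using effectD(5,6)[OF A, of x] effectD(5,6)[OF B, of x] by (simp_all add: cinner_expand)
qed (simp_all add: effectD[OF A] effectD[OF B] cinner_expand scaleC_add_right
    mult.commute)

text \<open>By polarization; the real part of the form separates operators, so the real version is
  enough.\<close>

lemma effect_eqI:
  assumes A: "A \<in> effects" and B: "B \<in> effects"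
    and form: "\<And>x. norm x = 1 \<Longrightarrow> Re (cinner (A x) x) = Re (cinner (B x) x)"
  shows "A = B"
proof -
  have q: "Re (cinner (A x) x) = Re (cinner (B x) x)" for x
  proof (cases "x = 0")
    case False
    let ?c = "complex_of_real (1 / norm x)"
    have "Re (cinner (A (?c *\<^sub>C x)) (?c *\<^sub>C x)) = Re (cinner (B (?c *\<^sub>C x)) (?c *\<^sub>C x))"
      using form normalized[OF False] by blast
    then show ?thesis
      using False by (simp add: effectD(2)[OF A] effectD(2)[OF B] cinner_expand)
  qed (simp add: effectD[OF A] effectD[OF B])
  have "Re (cinner (A x) y) = Re (cinner (B x) y)" for x y
    using q[of "x + y"] q[of x] q[of y] effectD(4)[OF A, of y x] effectD(4)[OF B, of y x]
      Re_cinner_commute[of y "A x"] Re_cinner_commute[of y "B x"]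
    by (simp add: effectD(1)[OF A] effectD(1)[OF B] cinner_expand)
  then show ?thesis by (intro ext Re_cinner_eqI)
qed

section \<open>Rank-one effects\<close>

definition rank1 :: "'a::complex_hilbert \<Rightarrow> 'a \<Rightarrow> 'a" where
  "rank1 x = (\<lambda>v. cinner v x *\<^sub>C x)"

lemma rank1_zero: "rank1 0 = (\<lambda>v. 0)"
  by (simp add: rank1_def)

lemma rank1_scaleC: "rank1 (c *\<^sub>C x) v = complex_of_real ((cmod c)\<^sup>2) *\<^sub>C rank1 x v"
  by (simp add: rank1_def cinner_scaleC_right complex_norm_square ac_simps
      del: of_real_power)

lemma rank1_phase: "cmod c = 1 \<Longrightarrow> rank1 (c *\<^sub>C x) = rank1 x"
  by (rule ext) (simp add: rank1_scaleC)

lemma rank1_self: "norm x = 1 \<Longrightarrow> rank1 x x = x"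
  by (simp add: rank1_def cinner_self)

lemma rank1_form: "cinner (rank1 x v) v = complex_of_real ((cmod (cinner v x))\<^sup>2)"
  by (metis rank1_def cinner_scaleC_left cinner_commute complex_norm_square)

text \<open>The Cauchy-Schwarz inequality is what makes \<open>rank1 x\<close> an effect for \<open>\<parallel>x\<parallel> \<le> 1\<close>.\<close>

lemma cmod_cinner_le: "cmod (cinner x y) \<le> norm x * norm (y::'a::complex_hilbert)"
proof (cases "y = 0")
  case False
  define u where "u = complex_of_real (1 / norm y) *\<^sub>C y"
  let ?p = "cinner x u *\<^sub>C u"
  have u: "norm u = 1" unfolding u_def by (rule normalized[OF False])
  have "cinner ?p (x - ?p) = 0"
    using cinner_self[of u] cinner_commute[of u x] by (simp add: cinner_expand u)
  then have "(norm x)\<^sup>2 = (norm ?p)\<^sup>2 + (norm (x - ?p))\<^sup>2"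
    using norm_add_orthogonal_square[of ?p "x - ?p"] by simp
  then have "norm ?p \<le> norm x" by (simp add: power2_le_imp_le)
  then have "cmod (cinner x u) \<le> norm x" by (simp add: norm_scaleC u)
  then show ?thesis
    using False by (simp add: u_def cinner_scaleC_right norm_divide pos_divide_le_eq)
qed simp

lemma rank1_effect:
  assumes "norm x \<le> 1"
  shows "rank1 x \<in> effects"
proof (rule effectI)
  fix v
  have "cmod (cinner v x) \<le> norm v"
    using cmod_cinner_le[of v x] assms mult_left_le[of "norm x" "norm v"] by simp
  then show "Re (cinner (rank1 x v) v) \<le> (norm v)\<^sup>2"
    by (simp add: rank1_form power_mono)
  show "0 \<le> Re (cinner (rank1 x v) v)" by (simp add: rank1_form)
  fix w
  show "cinner (rank1 x v) w = cinner v (rank1 x w)"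
    using cinner_commute[of x w] by (simp add: rank1_def cinner_expand mult.commute)
qed (simp_all add: rank1_def cinner_expand scaleC_add_left)

text \<open>Because \<open>B \<mapsto> A B A\<close> sends \<open>rank1 x\<close> to \<open>rank1 (A x)\<close>, the triple identity turns into a
  statement about vectors.\<close>

lemma conjugate_rank1: "A \<in> effects \<Longrightarrow> A \<circ> rank1 x \<circ> A = rank1 (A x)"
  by (rule ext) (simp add: rank1_def effectD(2,4))

lemma rank1_compress: "A \<in> effects \<Longrightarrow>
    rank1 x \<circ> A \<circ> rank1 x = (\<lambda>v. complex_of_real (Re (cinner (A x) x)) *\<^sub>C rank1 x v)"
  by (rule ext)
    (simp add: rank1_def effectD(2) cinner_scaleC_left mult.commute effect_form_real[symmetric])

section \<open>Sequential automorphisms permute the rays\<close>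

locale sequential_automorphism =
  fixes \<phi> :: "('a::complex_hilbert \<Rightarrow> 'a) \<Rightarrow> ('a \<Rightarrow> 'a)"
  assumes bij: "bij_betw \<phi> effects effects"
    and triple: "\<And>A B. A \<in> effects \<Longrightarrow> B \<in> effects \<Longrightarrow>
      \<phi> (A \<circ> B \<circ> A) = \<phi> A \<circ> \<phi> B \<circ> \<phi> A"
begin

lemma image_effect: "A \<in> effects \<Longrightarrow> \<phi> A \<in> effects"
  using bij by (auto simp: bij_betw_def)

lemma image_eqD: "\<phi> A = \<phi> B \<Longrightarrow> A \<in> effects \<Longrightarrow> B \<in> effects \<Longrightarrow> A = B"
  using bij by (auto simp: bij_betw_def inj_on_def)

lemma preimage:
  assumes "B \<in> effects"
  obtains A where "A \<in> effects" "\<phi> A = B"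
  using bij assms by (metis bij_betw_def imageE)

lemma inverse_automorphism: "sequential_automorphism (inv_into effects \<phi>)"
proof
  show "bij_betw (inv_into effects \<phi>) effects effects"
    by (rule bij_betw_inv_into[OF bij])
  fix C D :: "'a \<Rightarrow> 'a"
  assume "C \<in> effects" "D \<in> effects"
  then obtain A B where AB: "A \<in> effects" "\<phi> A = C" "B \<in> effects" "\<phi> B = D"
    by (metis preimage)
  then have "inv_into effects \<phi> (C \<circ> D \<circ> C) = A \<circ> B \<circ> A"
    using triple[of A B] inv_into_f_f[of \<phi> effects "A \<circ> B \<circ> A"] conjugate_effect[of A B] bij
    by (simp add: bij_betw_def)
  then show "inv_into effects \<phi> (C \<circ> D \<circ> C) =
      inv_into effects \<phi> C \<circ> inv_into effects \<phi> D \<circ> inv_into effects \<phi> C"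
    using AB bij by (auto simp: bij_betw_def)
qed

text \<open>With \<open>B\<close> the preimage of \<open>rank1 y\<close>, the triple identity for \<open>I\<close> and \<open>B\<close> forces \<open>\<phi> I\<close> to
  map a unit vector \<open>y\<close> to a multiple of itself by a phase, and this phase is \<open>1\<close> because \<open>\<phi> I\<close>
  is positive.\<close>

lemma image_id: "\<phi> id = id"
proof -
  have J: "\<phi> id \<in> effects" by (rule image_effect[OF id_effect])
  have unit: "\<phi> id y = y" if y: "norm y = 1" for y
  proof -
    obtain B where B: "B \<in> effects" "\<phi> B = rank1 y"
      using preimage[OF rank1_effect[of y]] y by auto
    then have "rank1 (\<phi> id y) = rank1 y"
      using triple[OF id_effect B(1)] by (simp add: conjugate_rank1[OF J])
    then have y_eq: "cinner y (\<phi> id y) *\<^sub>C \<phi> id y = y"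
      using rank1_self[OF y] by (metis rank1_def)
    define c where "c = Re (cinner (\<phi> id y) y)"
    have c: "cinner (\<phi> id y) y = complex_of_real c" "cinner y (\<phi> id y) = complex_of_real c"
      using effect_form_real[OF J, of y] effectD(4)[OF J, of y y] by (simp_all add: c_def)
    have "cinner (cinner y (\<phi> id y) *\<^sub>C \<phi> id y) y = 1"
      using y by (simp only: y_eq) (simp add: cinner_self)
    then have "complex_of_real (c * c) = 1" by (simp add: cinner_scaleC_left c)
    then have "c * c = 1" using of_real_eq_1_iff by blast
    moreover have "0 \<le> c" unfolding c_def by (rule effectD(5)[OF J])
    ultimately have "c = 1" by (metis abs_of_nonneg abs_square_eq_1 power2_eq_square)
    then show ?thesis using y_eq c by simp
  qed
  show ?thesis
    by (rule effect_eqI[OF J id_effect]) (simp add: unit)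
qed

lemma image_zero: "\<phi> (\<lambda>v. 0) = (\<lambda>v. 0)"
proof -
  obtain B where B: "B \<in> effects" "\<phi> B = (\<lambda>v. 0)" using preimage[OF zero_effect] .
  have "(\<lambda>v. 0) \<circ> B \<circ> (\<lambda>v::'a. 0::'a) = (\<lambda>v. 0)" by (simp add: fun_eq_iff)
  then show ?thesis
    using triple[OF zero_effect B(1)] B(2) effectD(3)[OF image_effect[OF zero_effect]]
    by (simp add: fun_eq_iff)
qed

lemma image_square: "A \<in> effects \<Longrightarrow> \<phi> (A \<circ> A) = \<phi> A \<circ> \<phi> A"
  using triple[OF _ id_effect, of A] by (simp add: image_id)

lemma square_effect: "A \<in> effects \<Longrightarrow> A \<circ> A \<in> effects"
  using conjugate_effect[OF _ id_effect, of A] by simp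

text \<open>The rank-one projections are the minimal nonzero idempotents, where the order on
  idempotents is expressed by \<open>P Q P = Q\<close>; all of this is visible to \<open>\<phi>\<close>.\<close>

lemma image_rank1:
  assumes x: "norm x = 1"
  shows "\<exists>x'. norm x' = 1 \<and> \<phi> (rank1 x) = rank1 x'"
proof -
  have R: "rank1 x \<in> effects" using x by (simp add: rank1_effect)
  let ?P = "\<phi> (rank1 x)"
  have P: "?P \<in> effects" by (rule image_effect[OF R])
  have "rank1 x \<circ> rank1 x = rank1 x"
    using x rank1_compress[OF id_effect, of x] by (simp add: Re_cinner_self)
  then have idem: "?P \<circ> ?P = ?P" using image_square[OF R] by simp
  have "rank1 x x \<noteq> 0" using x rank1_self[OF x] by auto
  then have "?P \<noteq> (\<lambda>v. 0)"
    using image_eqD[OF _ R zero_effect] image_zero by auto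
  then obtain v where v: "?P v \<noteq> 0" by auto
  define u where "u = complex_of_real (1 / norm (?P v)) *\<^sub>C ?P v"
  have u: "norm u = 1" unfolding u_def by (rule normalized[OF v])
  have "?P (?P v) = ?P v" using idem by (metis comp_apply)
  then have Pu: "?P u = u" by (simp add: u_def effectD(2)[OF P])
  have Ru: "rank1 u \<in> effects" using u by (simp add: rank1_effect)
  obtain Q where Q: "Q \<in> effects" "\<phi> Q = rank1 u" using preimage[OF Ru] .
  have "\<phi> (rank1 x \<circ> Q \<circ> rank1 x) = \<phi> Q"
    using triple[OF R Q(1)] by (simp add: Q(2) conjugate_rank1[OF P] Pu)
  then have below: "rank1 x \<circ> Q \<circ> rank1 x = Q"
    using image_eqD conjugate_effect R Q(1) by blast
  define c where "c = Re (cinner (Q x) x)"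
  have Q_eq: "Q = (\<lambda>v. complex_of_real c *\<^sub>C rank1 x v)"
    using below rank1_compress[OF Q(1), of x] by (simp add: c_def)
  have "rank1 u \<circ> rank1 u = rank1 u"
    using u rank1_compress[OF id_effect, of u] by (simp add: Re_cinner_self)
  then have "\<phi> (Q \<circ> Q) = \<phi> Q" using image_square[OF Q(1)] Q(2) by simp
  then have "Q \<circ> Q = Q" using image_eqD square_effect Q(1) by blast
  then have "Q (Q x) = Q x" by (metis comp_apply)
  then have "complex_of_real (c * c) *\<^sub>C x = complex_of_real c *\<^sub>C x"
    using rank1_self[OF x] by (simp add: Q_eq effectD(2)[OF R])
  then have "complex_of_real (c * c) = complex_of_real c" using x by auto
  then have "c * c = c" using of_real_eq_iff by blast
  moreover have "c \<noteq> 0"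
  proof
    assume "c = 0"
    then have "rank1 u = (\<lambda>v. 0)" using Q_eq Q(2) image_zero by simp
    then show False using rank1_self[OF u] u by auto
  qed
  ultimately have "c = 1" by simp
  then have "Q = rank1 x" using Q_eq by simp
  then show ?thesis using Q(2) u by blast
qed

text \<open>The action of \<open>\<phi>\<close> on rays, as a relation between representing unit vectors: no choice of
  phases is made.\<close>

definition ray_image :: "'a \<Rightarrow> 'a \<Rightarrow> bool" where
  "ray_image x x' \<longleftrightarrow> norm x = 1 \<and> norm x' = 1 \<and> \<phi> (rank1 x) = rank1 x'"

lemma ray_image_exists: "norm x = 1 \<Longrightarrow> \<exists>x'. ray_image x x'"
  using image_rank1 by (auto simp: ray_image_def)

lemma ray_preimage_exists:
  assumes "norm x' = 1"
  shows "\<exists>x. ray_image x x'"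
proof -
  obtain x where x: "norm x = 1" "inv_into effects \<phi> (rank1 x') = rank1 x"
    using sequential_automorphism.image_rank1[OF inverse_automorphism assms] by blast
  have "rank1 x' \<in> \<phi> ` effects"
    using bij assms rank1_effect[of x'] by (auto simp: bij_betw_def)
  then have "\<phi> (rank1 x) = rank1 x'" using f_inv_into_f x(2) by metis
  then show ?thesis using x assms by (auto simp: ray_image_def)
qed

lemma ray_image_phase:
  "ray_image x x' \<Longrightarrow> cmod c = 1 \<Longrightarrow> cmod d = 1 \<Longrightarrow> ray_image (c *\<^sub>C x) (d *\<^sub>C x')"
  by (simp add: ray_image_def norm_scaleC rank1_phase)

lemma ray_image_conjugate_eq:
  assumes "ray_image x x'" "A \<in> effects"
  shows "\<phi> (rank1 (A x)) = rank1 (\<phi> A x')"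
  using assms triple[of A "rank1 x"] image_effect[of A]
  by (simp add: ray_image_def rank1_effect conjugate_rank1)

text \<open>\<open>Q P Q\<close> vanishes exactly when the rank-one projections \<open>P\<close> and \<open>Q\<close> are orthogonal.\<close>

lemma ray_image_orthogonal:
  assumes x: "ray_image x x'" and y: "ray_image y y'"
  shows "cinner x y = 0 \<longleftrightarrow> cinner x' y' = 0"
proof -
  have norms: "norm x = 1" "norm y = 1" "norm x' = 1" "norm y' = 1"
    and img: "\<phi> (rank1 y) = rank1 y'"
    using x y by (auto simp: ray_image_def)
  have Ry: "rank1 y \<in> effects" using norms by (simp add: rank1_effect)
  have eq: "\<phi> (rank1 (cinner x y *\<^sub>C y)) = rank1 (cinner x' y' *\<^sub>C y')"
    using ray_image_conjugate_eq[OF x Ry] unfolding img by (simp add: rank1_def)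
  have zero: "rank1 (c *\<^sub>C z) = (\<lambda>v. 0) \<longleftrightarrow> c = 0" if "norm z = 1" for c and z :: 'a
  proof
    assume "rank1 (c *\<^sub>C z) = (\<lambda>v. 0)"
    then have "complex_of_real ((cmod c)\<^sup>2) *\<^sub>C z = 0"
      using rank1_scaleC[of c z z] rank1_self[OF that] by simp
    then show "c = 0" using that by auto
  qed (simp add: rank1_zero)
  have "norm (cinner x y *\<^sub>C y) \<le> 1"
    using cmod_cinner_le[of x y] norms by (simp add: norm_scaleC)
  then have "rank1 (cinner x y *\<^sub>C y) \<in> effects" by (rule rank1_effect)
  then have "rank1 (cinner x y *\<^sub>C y) = (\<lambda>v. 0) \<longleftrightarrow> rank1 (cinner x' y' *\<^sub>C y') = (\<lambda>v. 0)"
    using eq image_zero image_eqD zero_effect by metis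
  then show ?thesis using zero norms by simp
qed

section \<open>The quadratic form of an effect is preserved\<close>

text \<open>The function of \<open>t\<close> by which \<open>\<phi>\<close> acts on the multiples \<open>t P\<close> of a rank-one projection \<open>P\<close>;
  here \<open>x'\<close> spans the range of \<open>\<phi> P\<close>.\<close>

definition scalar_image :: "'a \<Rightarrow> real \<Rightarrow> real" where
  "scalar_image x' t = Re (cinner (\<phi> (\<lambda>v. complex_of_real t *\<^sub>C v) x') x')"

text \<open>\<open>P A P\<close> and \<open>P (t I) P\<close> agree when \<open>t = \<langle>A x, x\<rangle>\<close>, so their images agree as well.\<close>

lemma image_form:
  assumes x: "ray_image x x'" and A: "A \<in> effects"
  shows "Re (cinner (\<phi> A x') x') = scalar_image x' (Re (cinner (A x) x))"
proof -
  define t where "t = Re (cinner (A x) x)"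
  let ?S = "\<lambda>v::'a. complex_of_real t *\<^sub>C v"
  have norms: "norm x = 1" "norm x' = 1" and img: "\<phi> (rank1 x) = rank1 x'"
    using x by (auto simp: ray_image_def)
  have R: "rank1 x \<in> effects" using norms by (simp add: rank1_effect)
  have S: "?S \<in> effects"
    using effectD(5,6)[OF A, of x] norms by (intro scalar_effect) (simp_all add: t_def)
  have "Re (cinner (?S x) x) = t" using norms by (simp add: cinner_expand cinner_self)
  then have "rank1 x \<circ> A \<circ> rank1 x = rank1 x \<circ> ?S \<circ> rank1 x"
    by (simp only: rank1_compress[OF A] rank1_compress[OF S] flip: t_def)
  then have "rank1 x' \<circ> \<phi> A \<circ> rank1 x' = rank1 x' \<circ> \<phi> ?S \<circ> rank1 x'"
    using triple[OF R A] triple[OF R S] by (simp add: img)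
  then have "complex_of_real (Re (cinner (\<phi> A x') x')) *\<^sub>C x' =
      complex_of_real (Re (cinner (\<phi> ?S x') x')) *\<^sub>C x'"
    using fun_cong[of _ _ x'] rank1_self[OF norms(2)]
    by (simp only: rank1_compress[OF image_effect[OF A]] rank1_compress[OF image_effect[OF S]]) metis
  then have "Re (cinner (\<phi> A x') x') = Re (cinner (\<phi> ?S x') x')"
    using norms(2) by (metis complex_vector.scale_right_imp_eq of_real_eq_iff norm_zero zero_neq_one)
  then show ?thesis by (simp add: scalar_image_def t_def)
qed

lemma scalar_image_bounds:
  assumes "norm x' = 1" "0 \<le> t" "t \<le> 1"
  shows "0 \<le> scalar_image x' t" "scalar_image x' t \<le> 1"
  using effectD(5,6)[OF image_effect[OF scalar_effect[OF assms(2,3)]], of x'] assms(1)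
  by (simp_all add: scalar_image_def)

lemma scalar_image_zero: "scalar_image x' 0 = 0"
  using image_zero by (simp add: scalar_image_def)

lemma scalar_image_transition:
  assumes "ray_image x x'" "ray_image q q'"
  shows "scalar_image x' ((cmod (cinner x q))\<^sup>2) = (cmod (cinner x' q'))\<^sup>2"
  using image_form[OF assms(1) rank1_effect[of q]] assms(2)
  by (simp add: ray_image_def rank1_form)

text \<open>A vector in the span of \<open>x\<close>, \<open>y\<close>, \<open>z\<close> is orthogonal to everything that is orthogonal to
  all three, and this survives on the image side. So the image of its ray stays in the span of
  the images, where Parseval's identity holds.\<close>

lemma scalar_image_sum:
  assumes rays: "ray_image x x'" "ray_image y y'" "ray_image z z'"
    and orth: "cinner x y = 0" "cinner x z = 0" "cinner y z = 0"
    and abc: "0 \<le> a" "0 \<le> b" "0 \<le> c" "a + b + c = 1"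
  shows "scalar_image x' a + scalar_image y' b + scalar_image z' c = 1"
proof -
  have norms: "cinner x x = 1" "cinner y y = 1" "cinner z z = 1"
    "cinner x' x' = 1" "cinner y' y' = 1" "cinner z' z' = 1"
    using rays by (auto simp: ray_image_def cinner_self)
  have orth_rev: "cinner y x = 0" "cinner z x = 0" "cinner z y = 0"
    using orth cinner_commute[of y x] cinner_commute[of z x] cinner_commute[of z y] by auto
  have orth': "cinner x' y' = 0" "cinner x' z' = 0" "cinner y' z' = 0"
    "cinner y' x' = 0" "cinner z' x' = 0" "cinner z' y' = 0"
    using orth orth_rev rays ray_image_orthogonal by blast+
  define q where "q = complex_of_real (sqrt a) *\<^sub>C x + complex_of_real (sqrt b) *\<^sub>C y
    + complex_of_real (sqrt c) *\<^sub>C z"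
  have xq: "cinner x q = complex_of_real (sqrt a)" "cinner y q = complex_of_real (sqrt b)"
    "cinner z q = complex_of_real (sqrt c)"
    by (simp_all add: q_def cinner_expand norms orth orth_rev)
  have "cinner q q = complex_of_real (sqrt a * sqrt a + sqrt b * sqrt b + sqrt c * sqrt c)"
    by (simp add: q_def cinner_expand norms orth orth_rev del: real_sqrt_mult_self)
  then have "Re (cinner q q) = 1" using abc by simp
  then have "norm q = 1" by (simp add: Re_cinner_self power2_eq_1_iff)
      (metis norm_ge_zero le_minus_one_simps(3))
  then obtain q' where q': "ray_image q q'" using ray_image_exists by blast
  define r where "r = q' - (cinner q' x' *\<^sub>C x' + cinner q' y' *\<^sub>C y' + cinner q' z' *\<^sub>C z')"
  have r_orth: "cinner r x' = 0" "cinner r y' = 0" "cinner r z' = 0"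
    by (simp_all add: r_def cinner_expand norms orth')
  have "r = 0"
  proof (rule ccontr)
    assume r: "r \<noteq> 0"
    let ?c = "complex_of_real (1 / norm r)"
    obtain v where v: "ray_image v (?c *\<^sub>C r)"
      using ray_preimage_exists[OF normalized[OF r]] by blast
    have "cinner v x = 0" "cinner v y = 0" "cinner v z = 0"
      using ray_image_orthogonal[OF v] rays r_orth by (simp_all add: cinner_scaleC_left)
    then have "cinner v q = 0" by (simp add: q_def cinner_expand)
    then have "cinner r q' = 0"
      using ray_image_orthogonal[OF v q'] r by (simp add: cinner_scaleC_left)
    moreover have "cinner r r = cinner r q'"
      by (simp add: r_def cinner_diff_right cinner_add_right cinner_scaleC_right r_orth[unfolded r_def])
    ultimately show False using r cinner_eq_zero_iff by metis
  qed
  then have q'_eq: "q' = cinner q' x' *\<^sub>C x' + cinner q' y' *\<^sub>C y' + cinner q' z' *\<^sub>C z'"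
    by (simp add: r_def)
  have "cinner q' q' = cinner q' x' * cinner x' q' + cinner q' y' * cinner y' q'
      + cinner q' z' * cinner z' q'"
    by (subst (1) q'_eq) (simp only: cinner_add_left cinner_scaleC_left)
  also have "\<dots> = complex_of_real ((cmod (cinner x' q'))\<^sup>2 + (cmod (cinner y' q'))\<^sup>2
      + (cmod (cinner z' q'))\<^sup>2)"
    using cinner_commute[of q' x'] cinner_commute[of q' y'] cinner_commute[of q' z']
    by (simp add: complex_norm_square mult.commute del: of_real_power)
  finally have "(cmod (cinner x' q'))\<^sup>2 + (cmod (cinner y' q'))\<^sup>2 + (cmod (cinner z' q'))\<^sup>2 = 1"
    using q' by (metis cinner_self of_real_eq_iff one_power2 ray_image_def)
  then show ?thesis
    using scalar_image_transition[OF rays(1) q'] scalar_image_transition[OF rays(2) q']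
      scalar_image_transition[OF rays(3) q'] abc
    by (simp add: xq)
qed

end

text \<open>The deviation \<open>g t = f t - t\<close> from the identity is additive as well and vanishes at \<open>1\<close>,
  so \<open>\<bar>g t\<bar>\<close> doubles when passing to \<open>2 t\<close>, or to \<open>2 (1 - t)\<close> if \<open>2 t\<close> is too large. A bounded
  function cannot double forever.\<close>

lemma additive_unit_interval_identity:
  fixes f :: "real \<Rightarrow> real"
  assumes bounds: "\<And>t. 0 \<le> t \<Longrightarrow> t \<le> 1 \<Longrightarrow> 0 \<le> f t \<and> f t \<le> 1"
    and add: "\<And>s t. 0 \<le> s \<Longrightarrow> 0 \<le> t \<Longrightarrow> s + t \<le> 1 \<Longrightarrow> f (s + t) = f s + f t"
    and one: "f 1 = 1"
    and t: "0 \<le> t" "t \<le> 1"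
  shows "f t = t"
proof -
  have small: "2 ^ n * \<bar>f t - t\<bar> \<le> 1" if "0 \<le> t" "t \<le> 1" for n t
    using that
  proof (induction n arbitrary: t)
    case 0
    then show ?case using bounds[of t] by (simp add: abs_le_iff)
  next
    case (Suc n)
    show ?case
    proof (cases "2 * t \<le> 1")
      case True
      then have "f (2 * t) - 2 * t = 2 * (f t - t)" using add[of t t] Suc.prems by simp
      then have "\<bar>f (2 * t) - 2 * t\<bar> = 2 * \<bar>f t - t\<bar>" by (simp only: abs_mult)
      then show ?thesis using Suc.IH[of "2 * t"] Suc.prems True
        by (simp add: mult.assoc mult.left_commute)
    next
      case False
      define s where "s = 1 - t"
      have s: "0 \<le> s" "2 * s \<le> 1" using False Suc.prems by (simp_all add: s_def)
      have "f s - s = - (f t - t)" using add[of s t] Suc.prems s one by (simp add: s_def)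
      moreover have "f (2 * s) - 2 * s = 2 * (f s - s)" using add[of s s] s by simp
      ultimately have "\<bar>f (2 * s) - 2 * s\<bar> = 2 * \<bar>f t - t\<bar>"
        by (simp only: abs_mult abs_minus_cancel)
      then show ?thesis using Suc.IH[of "2 * s"] s by (simp add: mult.assoc mult.left_commute)
    qed
  qed
  show ?thesis
  proof (rule ccontr)
    assume "f t \<noteq> t"
    then obtain n where "1 / \<bar>f t - t\<bar> < 2 ^ n"
      using real_arch_pow[of 2] by auto
    then show False using small[OF t, of n] \<open>f t \<noteq> t\<close> by (simp add: pos_divide_less_eq)
  qed
qed

context sequential_automorphism
begin

text \<open>For an orthonormal triple the three functions add up to \<open>1\<close> at any \<open>a + b + c = 1\<close>.
  Setting one or two of the arguments to \<open>0\<close> shows that the functions coincide and are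
  additive.\<close>

lemma scalar_image_identity:
  assumes dim: "cdim_at_least TYPE('a) 3"
    and x: "ray_image x x'" and t: "0 \<le> t" "t \<le> 1"
  shows "scalar_image x' t = t"
proof -
  have nx: "norm x = 1" and nx': "norm x' = 1" using x by (auto simp: ray_image_def)
  obtain y where y: "norm y = 1" "cinner x y = 0"
    using exists_unit_orthogonal[OF dim nx nx] by blast
  obtain z where z: "norm z = 1" "cinner x z = 0" "cinner y z = 0"
    using exists_unit_orthogonal[OF dim nx y(1)] y(2) by blast
  obtain y' z' where rays: "ray_image y y'" "ray_image z z'"
    using y(1) z(1) ray_image_exists by blast
  have sum: "scalar_image x' a + scalar_image y' b + scalar_image z' c = 1"
    if "0 \<le> a" "0 \<le> b" "0 \<le> c" "a + b + c = 1" for a b c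
    using scalar_image_sum[OF x rays y(2) z(2,3) that] .
  note zero = scalar_image_zero[of x'] scalar_image_zero[of y'] scalar_image_zero[of z']
  have xy: "scalar_image y' b = scalar_image x' b" if "0 \<le> b" "b \<le> 1" for b
    using sum[of b 0 "1 - b"] sum[of 0 b "1 - b"] that zero by simp
  have add: "scalar_image x' (a + b) = scalar_image x' a + scalar_image x' b"
    if "0 \<le> a" "0 \<le> b" "a + b \<le> 1" for a b
    using sum[of a b "1 - (a + b)"] sum[of "a + b" 0 "1 - (a + b)"] xy[of b] that zero by simp
  have "scalar_image x' 1 = 1" using sum[of 1 0 0] zero by simp
  then show ?thesis
    using additive_unit_interval_identity[of "scalar_image x'" t] scalar_image_bounds[OF nx'] add t
    by blast
qed

lemma image_form_eq:
  assumes "cdim_at_least TYPE('a) 3" "ray_image x x'" "A \<in> effects"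
  shows "Re (cinner (\<phi> A x') x') = Re (cinner (A x) x)"
  using image_form[OF assms(2,3)] scalar_image_identity[OF assms(1,2)]
    effectD(5,6)[OF assms(3), of x] assms(2)
  by (simp add: ray_image_def)

end

section \<open>Wigner's theorem\<close>

lemma unit_vectors_parallel:
  fixes x y :: "'a::complex_hilbert"
  assumes "norm x = 1" "norm y = 1" "cmod (cinner x y) = 1"
  shows "x = cinner x y *\<^sub>C y"
proof -
  have "cinner x (cinner x y *\<^sub>C y) = 1"
    using assms(3) complex_norm_square[of "cinner x y"]
      by (simp add: cinner_scaleC_right mult.commute)
  then have "(norm (x - cinner x y *\<^sub>C y))\<^sup>2 = 0"
    unfolding norm_diff_square norm_scaleC using assms by simp
  then show ?thesis by simp
qed

text \<open>A correspondence between rays, given on representing unit vectors. Besides the transition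
  probabilities it respects the real part of the cyclic product of three inner products, which
  does not depend on the phases of the three vectors.\<close>

locale ray_correspondence =
  fixes \<rho> :: "'a::complex_hilbert \<Rightarrow> 'a \<Rightarrow> bool"
  assumes unit: "\<rho> x x' \<Longrightarrow> norm x = 1 \<and> norm x' = 1"
    and total: "norm x = 1 \<Longrightarrow> \<exists>x'. \<rho> x x'"
    and surj: "norm x' = 1 \<Longrightarrow> \<exists>x. \<rho> x x'"
    and phase: "\<rho> x x' \<Longrightarrow> cmod c = 1 \<Longrightarrow> cmod d = 1 \<Longrightarrow> \<rho> (c *\<^sub>C x) (d *\<^sub>C x')"
    and transition: "\<rho> x x' \<Longrightarrow> \<rho> y y' \<Longrightarrow> cmod (cinner x' y') = cmod (cinner x y)"
    and cycle: "\<rho> x x' \<Longrightarrow> \<rho> y y' \<Longrightarrow> \<rho> z z' \<Longrightarrow>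
      Re (cinner x' y' * cinner y' z' * cinner z' x') = Re (cinner x y * cinner y z * cinner z x)"

text \<open>The rays not orthogonal to a unit vector \<open>b\<close> are parametrized by the vectors \<open>z\<close>
  orthogonal to \<open>b\<close>: every such ray contains exactly one vector \<open>b + z\<close>, which is then
  normalized.\<close>

definition lift :: "'a::complex_hilbert \<Rightarrow> 'a \<Rightarrow> 'a" where
  "lift b z = complex_of_real (1 / sqrt (1 + (norm z)\<^sup>2)) *\<^sub>C (b + z)"

lemma cinner_lift:
  assumes "norm b = 1" "cinner z b = 0" "cinner w b = 0"
  shows "cinner (lift b z) (lift b w) =
    complex_of_real (1 / (sqrt (1 + (norm z)\<^sup>2) * sqrt (1 + (norm w)\<^sup>2))) * (1 + cinner z w)"
  using assms cinner_commute[of b w]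
  by (simp add: lift_def cinner_expand cinner_self add_divide_distrib)

lemma cinner_lift_base:
  assumes "norm b = 1" "cinner z b = 0"
  shows "cinner (lift b z) b = complex_of_real (1 / sqrt (1 + (norm z)\<^sup>2))"
    "cinner b (lift b z) = complex_of_real (1 / sqrt (1 + (norm z)\<^sup>2))"
  using assms cinner_commute[of b z] by (simp_all add: lift_def cinner_expand cinner_self)

lemma one_plus_square_pos: "0 < 1 + (a::real)\<^sup>2"
  by (simp add: add_pos_nonneg)

lemma norm_lift:
  assumes "norm b = 1" "cinner z b = 0"
  shows "norm (lift b z) = 1"
proof -
  have "(norm (b + z))\<^sup>2 = 1 + (norm z)\<^sup>2"
    using norm_add_orthogonal_square[of b z] assms cinner_commute[of b z] by simp
  then have "norm (b + z) = sqrt (1 + (norm z)\<^sup>2)"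
    by (metis norm_ge_zero real_sqrt_unique)
  then show ?thesis
    using one_plus_square_pos[of "norm z"] unfolding lift_def norm_scaleC
      by (simp add: norm_divide)
qed

lemma lift_exists:
  assumes b: "norm b = 1" and u: "norm u = 1" "cinner u b \<noteq> 0"
  shows "\<exists>c z. cmod c = 1 \<and> cinner z b = 0 \<and> u = c *\<^sub>C lift b z"
proof -
  define k where "k = cinner u b"
  define z where "z = (1 / k) *\<^sub>C u - b"
  have k: "k \<noteq> 0" using u(2) by (simp add: k_def)
  have zb: "cinner z b = 0"
    using k b by (simp add: z_def cinner_expand cinner_self flip: k_def)
  have bz: "b + z = (1 / k) *\<^sub>C u" by (simp add: z_def)
  have "1 + (norm z)\<^sup>2 = (norm (b + z))\<^sup>2"
    using norm_add_orthogonal_square[of b z] b zb cinner_commute[of b z] by simp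
  also have "\<dots> = (1 / cmod k)\<^sup>2" unfolding bz norm_scaleC u(1) by (simp add: norm_divide)
  finally have "sqrt (1 + (norm z)\<^sup>2) = 1 / cmod k" by simp
  then have "lift b z = (complex_of_real (cmod k) / k) *\<^sub>C u"
    by (simp add: lift_def bz)
  then have "u = (k / complex_of_real (cmod k)) *\<^sub>C lift b z" using k by simp
  moreover have "cmod (k / complex_of_real (cmod k)) = 1" using k by (simp add: norm_divide)
  ultimately show ?thesis using zb by blast
qed

text \<open>In these coordinates around a pair \<open>e\<close>, \<open>e'\<close> of corresponding rays, the correspondence
  becomes a map that preserves \<open>Re \<langle>z, w\<rangle>\<close> (by the cyclic products with \<open>e\<close>) and \<open>\<bar>1 + \<langle>z, w\<rangle>\<bar>\<close>
  (by the transition probabilities).\<close>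

locale based_ray_correspondence = ray_correspondence \<rho>
  for \<rho> :: "'a::complex_hilbert \<Rightarrow> 'a \<Rightarrow> bool" +
  fixes e e' :: 'a
  assumes base: "\<rho> e e'"
begin

lemma base_unit: "norm e = 1" "norm e' = 1"
  using unit[OF base] by auto

definition chart_image :: "'a \<Rightarrow> 'a \<Rightarrow> bool" where
  "chart_image z z' \<longleftrightarrow> cinner z e = 0 \<and> cinner z' e' = 0 \<and> \<rho> (lift e z) (lift e' z')"

lemma chart_image_total:
  assumes z: "cinner z e = 0"
  shows "\<exists>z'. chart_image z z'"
proof -
  obtain x' where x': "\<rho> (lift e z) x'" using total norm_lift[OF base_unit(1) z] by blast
  have "cmod (cinner x' e') = cmod (cinner (lift e z) e)" by (rule transition[OF x' base])
  then have "cinner x' e' \<noteq> 0"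
    using one_plus_square_pos[of "norm z"] by (auto simp: cinner_lift_base[OF base_unit(1) z])
  then obtain c z' where c: "cmod c = 1" "cinner z' e' = 0" "x' = c *\<^sub>C lift e' z'"
    using lift_exists[OF base_unit(2)] unit[OF x'] by blast
  then have "(1 / c) *\<^sub>C x' = lift e' z'" by auto
  moreover have "\<rho> (1 *\<^sub>C lift e z) ((1 / c) *\<^sub>C x')"
    using phase[OF x', of 1 "1 / c"] c by (simp add: norm_divide)
  ultimately show ?thesis using z c(2) by (auto simp: chart_image_def)
qed

lemma chart_image_surj:
  assumes z': "cinner z' e' = 0"
  shows "\<exists>z. chart_image z z'"
proof -
  obtain x where x: "\<rho> x (lift e' z')" using surj norm_lift[OF base_unit(2) z'] by blast
  have "cmod (cinner (lift e' z') e') = cmod (cinner x e)" by (rule transition[OF x base])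
  then have "cinner x e \<noteq> 0"
    using one_plus_square_pos[of "norm z'"] by (auto simp: cinner_lift_base[OF base_unit(2) z'])
  then obtain c z where c: "cmod c = 1" "cinner z e = 0" "x = c *\<^sub>C lift e z"
    using lift_exists[OF base_unit(1)] unit[OF x] by blast
  then have "(1 / c) *\<^sub>C x = lift e z" by auto
  moreover have "\<rho> ((1 / c) *\<^sub>C x) (1 *\<^sub>C lift e' z')"
    using phase[OF x, of "1 / c" 1] c by (simp add: norm_divide)
  ultimately show ?thesis using z' c(2) by (auto simp: chart_image_def)
qed

lemma chart_image_norm:
  assumes "chart_image z z'"
  shows "norm z' = norm z"
proof -
  have "cmod (cinner (lift e' z') e') = cmod (cinner (lift e z) e)"
    using assms transition[OF _ base] by (auto simp: chart_image_def)
  then have "1 / sqrt (1 + (norm z')\<^sup>2) = 1 / sqrt (1 + (norm z)\<^sup>2)"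
    using assms one_plus_square_pos[of "norm z"] one_plus_square_pos[of "norm z'"]
    by (auto simp: chart_image_def cinner_lift_base base_unit norm_divide)
  then show ?thesis by simp
qed

lemma chart_image_cmod:
  assumes z: "chart_image z z'" and w: "chart_image w w'"
  shows "cmod (1 + cinner z' w') = cmod (1 + cinner z w)"
proof -
  have "cmod (cinner (lift e' z') (lift e' w')) = cmod (cinner (lift e z) (lift e w))"
    using z w transition by (auto simp: chart_image_def)
  then show ?thesis
    using z w one_plus_square_pos[of "norm z"] one_plus_square_pos[of "norm w"]
      chart_image_norm[OF z] chart_image_norm[OF w]
    by (auto simp: chart_image_def cinner_lift base_unit norm_mult norm_divide)
qed

lemma chart_image_Re:
  assumes z: "chart_image z z'" and w: "chart_image w w'"
  shows "Re (cinner z' w') = Re (cinner z w)"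
proof -
  let ?k = "1 / sqrt (1 + (norm z)\<^sup>2)" and ?l = "1 / sqrt (1 + (norm w)\<^sup>2)"
    and ?m = "1 / (sqrt (1 + (norm z)\<^sup>2) * sqrt (1 + (norm w)\<^sup>2))"
  have prod: "cinner b (lift b x) * cinner (lift b x) (lift b y) * cinner (lift b y) b =
      complex_of_real (?k * ?m * ?l) * (1 + cinner x y)"
    if "norm b = 1" "cinner x b = 0" "cinner y b = 0" "norm x = norm z" "norm y = norm w"
    for b x y :: 'a
    using that by (simp add: cinner_lift cinner_lift_base)
  have Re_scale: "Re (complex_of_real r * (1 + c)) = r * (1 + Re c)" for r c
    by simp
  have "Re (complex_of_real (?k * ?m * ?l) * (1 + cinner z' w')) =
      Re (complex_of_real (?k * ?m * ?l) * (1 + cinner z w))"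
    using cycle[OF base, of "lift e z" "lift e' z'" "lift e w" "lift e' w'"] z w
      prod[of e z w] prod[of e' z' w'] chart_image_norm[OF z] chart_image_norm[OF w] base_unit
    unfolding chart_image_def by metis
  then have "?k * ?m * ?l * (1 + Re (cinner z' w')) = ?k * ?m * ?l * (1 + Re (cinner z w))"
    by (simp only: Re_scale)
  moreover have "?k * ?m * ?l \<noteq> 0"
    using one_plus_square_pos[of "norm z"] one_plus_square_pos[of "norm w"] by simp
  ultimately show ?thesis by simp
qed

definition chart_map :: "'a \<Rightarrow> 'a" where
  "chart_map z = (SOME z'. chart_image z z')"

lemma chart_image_chart_map: "cinner z e = 0 \<Longrightarrow> chart_image z (chart_map z)"
  unfolding chart_map_def by (rule someI_ex[OF chart_image_total])

lemma chart_map_orthogonal: "cinner z e = 0 \<Longrightarrow> cinner (chart_map z) e' = 0"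
  using chart_image_chart_map by (auto simp: chart_image_def)

lemma chart_map_Re: "cinner z e = 0 \<Longrightarrow> cinner w e = 0 \<Longrightarrow> Re (cinner (chart_map z) (chart_map w)) =
  Re (cinner z w)"
  using chart_image_Re chart_image_chart_map by blast

lemma chart_map_surj:
  assumes "cinner z' e' = 0"
  shows "\<exists>z. cinner z e = 0 \<and> chart_map z = z'"
proof -
  obtain z where z: "chart_image z z'" using chart_image_surj[OF assms] by blast
  then have ze: "cinner z e = 0" by (simp add: chart_image_def)
  note Tz = chart_image_chart_map[OF ze]
  have "(norm (chart_map z - z'))\<^sup>2 = 0"
    using chart_image_Re[OF Tz Tz] chart_image_Re[OF Tz z] chart_image_Re[OF z Tz]
      chart_image_Re[OF z z]
    by (simp add: Re_cinner_self[symmetric] cinner_expand)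
  then show ?thesis using ze by auto
qed

text \<open>The squared norm of \<open>chart_map (z + w) - (chart_map z + chart_map w)\<close> expands into inner
  products that the chart map preserves, so it equals \<open>\<parallel>(z + w) - (z + w)\<parallel>\<^sup>2\<close>; the same works
  for real scalars.\<close>

lemma chart_map_add:
  assumes "cinner z e = 0" "cinner w e = 0"
  shows "chart_map (z + w) = chart_map z + chart_map w"
proof -
  have "cinner (z + w) e = 0" using assms by (simp add: cinner_add_left)
  then have "(norm (chart_map (z + w) - (chart_map z + chart_map w)))\<^sup>2 = 0"
    using assms by (simp add: Re_cinner_self[symmetric] cinner_expand chart_map_Re)
  then show ?thesis by simp
qed

lemma chart_map_real_scale:
  assumes "cinner z e = 0"
  shows "chart_map (complex_of_real r *\<^sub>C z) = complex_of_real r *\<^sub>C chart_map z"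
proof -
  have "cinner (complex_of_real r *\<^sub>C z) e = 0" using assms by (simp add: cinner_scaleC_left)
  then have "(norm (chart_map (complex_of_real r *\<^sub>C z) - complex_of_real r *\<^sub>C chart_map z))\<^sup>2 =
    0"
    using assms by (simp add: Re_cinner_self[symmetric] cinner_expand chart_map_Re)
  then show ?thesis by simp
qed

text \<open>Knowing \<open>Re \<langle>z, w\<rangle>\<close> and \<open>\<bar>1 + \<langle>z, w\<rangle>\<bar>\<close> determines \<open>\<langle>z, w\<rangle>\<close> up to conjugation. For \<open>w = i
  z\<close> the two possibilities are \<open>chart_map (i z) = i chart_map z\<close> and \<open>chart_map (i z) = - i
  chart_map z\<close>.\<close>

lemma chart_map_imaginary:
  assumes z: "cinner z e = 0"
  shows "chart_map (\<i> *\<^sub>C z) = \<i> *\<^sub>C chart_map z \<or> chart_map (\<i> *\<^sub>C z) = (- \<i>) *\<^sub>C chart_map z"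
proof -
  have iz: "cinner (\<i> *\<^sub>C z) e = 0" using z by (simp add: cinner_scaleC_left)
  define a where "a = cinner (chart_map (\<i> *\<^sub>C z)) (chart_map z)"
  have Re_a: "Re a = 0" unfolding a_def chart_map_Re[OF iz z]
    by (simp add: cinner_scaleC_left cinner_self)
  have "cmod (1 + a) = cmod (1 + \<i> * complex_of_real ((norm z)\<^sup>2))"
    using chart_image_cmod[OF chart_image_chart_map[OF iz] chart_image_chart_map[OF z]]
      by (simp add: a_def cinner_scaleC_left cinner_self)
  then have "(cmod (1 + a))\<^sup>2 = (cmod (1 + \<i> * complex_of_real ((norm z)\<^sup>2)))\<^sup>2" by simp
  then have "(Im a)\<^sup>2 = ((norm z)\<^sup>2)\<^sup>2" by (simp add: cmod_power2 Re_a del: of_real_power)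
  then have Im_a: "Im a = (norm z)\<^sup>2 \<or> Im a = - (norm z)\<^sup>2" by (simp only: power2_eq_iff)
  have nT: "norm (chart_map z) = norm z" using chart_image_norm[OF chart_image_chart_map[OF z]] .
  have nTi: "norm (chart_map (\<i> *\<^sub>C z)) = norm z"
    using chart_image_norm[OF chart_image_chart_map[OF iz]] by (simp add: norm_scaleC)
  have "(norm (chart_map (\<i> *\<^sub>C z) - d *\<^sub>C chart_map z))\<^sup>2 = 2 * (norm z)\<^sup>2 - 2 * Im d * Im a"
    if "d = \<i> \<or> d = - \<i>" for d
    using that unfolding norm_diff_square norm_scaleC cinner_scaleC_right a_def[symmetric] nT nTi
    by (auto simp: Re_a)
  from this[of \<i>] this[of "- \<i>"] Im_a
  have "norm (chart_map (\<i> *\<^sub>C z) - \<i> *\<^sub>C chart_map z) = 0 \<or>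
    norm (chart_map (\<i> *\<^sub>C z) - (- \<i>) *\<^sub>C chart_map z) = 0"
    by auto
  then show ?thesis by (simp only: norm_eq_zero right_minus_eq)
qed

text \<open>The sign cannot vary: if \<open>z\<close> and \<open>w\<close> had different signs, additivity would force \<open>z + w\<close>
  to follow both.\<close>

lemma chart_map_imaginary_uniform:
  "(\<forall>z. cinner z e = 0 \<longrightarrow> chart_map (\<i> *\<^sub>C z) = \<i> *\<^sub>C chart_map z) \<or>
   (\<forall>z. cinner z e = 0 \<longrightarrow> chart_map (\<i> *\<^sub>C z) = (- \<i>) *\<^sub>C chart_map z)"
proof (rule ccontr)
  assume "\<not> ?thesis"
  then obtain z w where z: "cinner z e = 0" "chart_map (\<i> *\<^sub>C z) \<noteq> \<i> *\<^sub>C chart_map z"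
    and w: "cinner w e = 0" "chart_map (\<i> *\<^sub>C w) \<noteq> (- \<i>) *\<^sub>C chart_map w" by blast
  have zi: "chart_map (\<i> *\<^sub>C z) = (- \<i>) *\<^sub>C chart_map z" using z chart_map_imaginary by blast
  have wi: "chart_map (\<i> *\<^sub>C w) = \<i> *\<^sub>C chart_map w" using w chart_map_imaginary by blast
  have zw: "cinner (z + w) e = 0" using z w by (simp add: cinner_add_left)
  have "chart_map (\<i> *\<^sub>C (z + w)) = (- \<i>) *\<^sub>C chart_map z + \<i> *\<^sub>C chart_map w"
    using z(1) w(1) chart_map_add[of "\<i> *\<^sub>C z" "\<i> *\<^sub>C w"]
      by (simp add: scaleC_add_right cinner_scaleC_left zi wi)
  moreover have "chart_map (\<i> *\<^sub>C (z + w)) = \<i> *\<^sub>C chart_map z + \<i> *\<^sub>C chart_map w \<or>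
      chart_map (\<i> *\<^sub>C (z + w)) = (- \<i>) *\<^sub>C chart_map z + (- \<i>) *\<^sub>C chart_map w"
    using chart_map_imaginary[OF zw] chart_map_add[OF z(1) w(1)] by (simp only: scaleC_add_right)
  ultimately have "(- \<i>) *\<^sub>C chart_map z = \<i> *\<^sub>C chart_map z \<or> \<i> *\<^sub>C chart_map w =
    (- \<i>) *\<^sub>C chart_map w" by auto
  then show False using zi wi z(2) w(2) by auto
qed

text \<open>Both cases are treated at once, with the identity or the conjugation of \<open>\<complex>\<close> as \<open>\<sigma>\<close>.\<close>

lemma chart_map_semilinear:
  obtains \<sigma> where "\<sigma> = (\<lambda>c. c) \<or> \<sigma> = cnj"
    "\<And>c z. cinner z e = 0 \<Longrightarrow> chart_map (c *\<^sub>C z) = \<sigma> c *\<^sub>C chart_map z"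
    "\<And>z w. cinner z e = 0 \<Longrightarrow> cinner w e = 0 \<Longrightarrow> cinner (chart_map z) (chart_map w) = \<sigma> (cinner z w)"
proof -
  obtain \<sigma> where \<sigma>: "\<sigma> = (\<lambda>c. c) \<or> \<sigma> = cnj"
    and i: "\<And>z. cinner z e = 0 \<Longrightarrow> chart_map (\<i> *\<^sub>C z) = \<sigma> \<i> *\<^sub>C chart_map z"
  proof -
    have "\<exists>\<sigma>. (\<sigma> = (\<lambda>c. c) \<or> \<sigma> = cnj) \<and> (\<forall>z. cinner z e = 0 \<longrightarrow> chart_map (\<i> *\<^sub>C z) =
      \<sigma> \<i> *\<^sub>C chart_map z)"
      using chart_map_imaginary_uniform
    proof
      assume "\<forall>z. cinner z e = 0 \<longrightarrow> chart_map (\<i> *\<^sub>C z) = \<i> *\<^sub>C chart_map z"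
      then show ?thesis by (intro exI[of _ "\<lambda>c. c"]) simp
    next
      assume "\<forall>z. cinner z e = 0 \<longrightarrow> chart_map (\<i> *\<^sub>C z) = (- \<i>) *\<^sub>C chart_map z"
      then show ?thesis by (intro exI[of _ cnj]) simp
    qed
    then show thesis using that by blast
  qed
  have scale: "chart_map (c *\<^sub>C z) = \<sigma> c *\<^sub>C chart_map z" if z: "cinner z e = 0" for c z
  proof -
    have c: "c = complex_of_real (Re c) + complex_of_real (Im c) * \<i>"
      by (simp add: complex_eq_iff)
    have "chart_map (c *\<^sub>C z) =
      chart_map (complex_of_real (Re c) *\<^sub>C z + complex_of_real (Im c) *\<^sub>C \<i> *\<^sub>C z)"
      by (subst c) (simp only: scaleC_add_left scaleC_scaleC)
    also have "\<dots> = complex_of_real (Re c) *\<^sub>C chart_map z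
        + complex_of_real (Im c) *\<^sub>C \<sigma> \<i> *\<^sub>C chart_map z"
      using z by (simp add: chart_map_add chart_map_real_scale i cinner_scaleC_left
          del: complex_vector.scale_scale)
    also have "\<dots> = \<sigma> c *\<^sub>C chart_map z"
    proof -
      have "\<sigma> c = complex_of_real (Re c) + complex_of_real (Im c) * \<sigma> \<i>"
        using \<sigma> by (auto simp: complex_eq_iff)
      then show ?thesis by (simp only: scaleC_add_left scaleC_scaleC)
    qed
    finally show ?thesis .
  qed
  have "cinner (chart_map z) (chart_map w) = \<sigma> (cinner z w)"
    if z: "cinner z e = 0" and w: "cinner w e = 0" for z w
  proof -
    have iw: "cinner (\<i> *\<^sub>C w) e = 0" using w by (simp add: cinner_scaleC_left)
    have "Re (cinner (chart_map z) (\<sigma> \<i> *\<^sub>C chart_map w)) = Re (cinner z (\<i> *\<^sub>C w))"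
      using chart_map_Re[OF z iw] i[OF w] by simp
    then show ?thesis
      using chart_map_Re[OF z w] \<sigma> by (auto simp: complex_eq_iff cinner_scaleC_right)
  qed
  then show thesis using that \<sigma> scale by blast
qed

end

text \<open>With \<open>e\<close> sent to \<open>e'\<close> and its orthogonal complement moved by the chart map, the semilinear
  extension \<open>U\<close> induces the correspondence on all rays not orthogonal to \<open>e\<close>; the transition
  probabilities to those rays then determine it on the remaining ones.\<close>

theorem (in ray_correspondence) wigner:
  assumes "\<exists>e::'a. norm e = 1"
  shows "\<exists>U. (unitary_op U \<or> antiunitary_op U) \<and>
    (\<forall>x x'. \<rho> x x' \<longrightarrow> (\<exists>c. cmod c = 1 \<and> x' = c *\<^sub>C U x))"
proof -
  obtain e e' where "\<rho> e e'" using assms total by blast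
  then interpret based_ray_correspondence \<rho> e e' by unfold_locales
  obtain \<sigma> where \<sigma>: "\<sigma> = (\<lambda>c. c) \<or> \<sigma> = cnj"
    and chart_map_scale: "\<And>c z. cinner z e = 0 \<Longrightarrow> chart_map (c *\<^sub>C z) = \<sigma> c *\<^sub>C chart_map z"
    and chart_map_inner: "\<And>z w. cinner z e = 0 \<Longrightarrow> cinner w e = 0 \<Longrightarrow>
      cinner (chart_map z) (chart_map w) = \<sigma> (cinner z w)"
    using chart_map_semilinear by blast
  have ee: "cinner e e = 1" "cinner e' e' = 1" using base_unit by (simp_all add: cinner_self)
  have chart_map_orth: "cinner (chart_map z) e' = 0" "cinner e' (chart_map z) = 0"
    if "cinner z e = 0" for z
    using chart_map_orthogonal[OF that] cinner_commute[of e' "chart_map z"] by simp_all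
  define p where "p v = v - cinner v e *\<^sub>C e" for v :: 'a
  have p: "cinner (p v) e = 0" for v by (simp add: p_def cinner_expand ee)
  have p': "cinner e (p v) = 0" for v using p cinner_commute[of e "p v"] by simp
  have split: "v = cinner v e *\<^sub>C e + p v" for v by (simp add: p_def)
  define U where "U v = \<sigma> (cinner v e) *\<^sub>C e' + chart_map (p v)" for v
  have U_split: "U (c *\<^sub>C e + z) = \<sigma> c *\<^sub>C e' + chart_map z" if "cinner z e = 0" for c z
    using that by (simp add: U_def p_def cinner_expand ee)
  have U_add: "U (v + w) = U v + U w" for v w
  proof -
    have "p (v + w) = p v + p w" by (simp add: p_def cinner_add_left scaleC_add_left)
    moreover have "\<sigma> (cinner v e + cinner w e) = \<sigma> (cinner v e) + \<sigma> (cinner w e)" using \<sigma> by auto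
    ultimately show ?thesis using chart_map_add[OF p p]
      by (simp add: U_def cinner_add_left scaleC_add_left)
  qed
  have U_scale: "U (c *\<^sub>C v) = \<sigma> c *\<^sub>C U v" for c v
  proof -
    have "p (c *\<^sub>C v) = c *\<^sub>C p v"
      by (simp add: p_def cinner_scaleC_left complex_vector.scale_right_diff_distrib)
    moreover have "\<sigma> (c * cinner v e) = \<sigma> c * \<sigma> (cinner v e)" using \<sigma> by auto
    ultimately show ?thesis using chart_map_scale[OF p]
      by (simp add: U_def cinner_scaleC_left scaleC_add_right)
  qed
  have U_inner: "cinner (U v) (U w) = \<sigma> (cinner v w)" for v w
  proof -
    have "cinner v w = cinner v e * cnj (cinner w e) + cinner (p v) (p w)"
      by (subst (1) split[of v], subst (1) split[of w]) (simp add: cinner_expand ee p p')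
    moreover have "cinner (U v) (U w) =
      \<sigma> (cinner v e) * cnj (\<sigma> (cinner w e)) + \<sigma> (cinner (p v) (p w))"
      by (simp add: U_def cinner_expand ee chart_map_orth p chart_map_inner)
    ultimately show ?thesis using \<sigma> by auto
  qed
  have "inj U"
  proof (rule injI)
    fix v w
    assume eq: "U v = U w"
    have "\<sigma> (cinner x v) = \<sigma> (cinner x w)" for x
      using U_inner[of x v] U_inner[of x w] eq by simp
    then show "v = w" using \<sigma> by (intro cinner_eqI) auto
  qed
  moreover have "\<exists>v. y = U v" for y
  proof -
    define y' where "y' = y - cinner y e' *\<^sub>C e'"
    have "cinner y' e' = 0" by (simp add: y'_def cinner_expand ee)
    then obtain z where z: "cinner z e = 0" "chart_map z = y'" using chart_map_surj by blast
    have "\<sigma> (\<sigma> (cinner y e')) = cinner y e'" using \<sigma> by auto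
    then have "U (\<sigma> (cinner y e') *\<^sub>C e + z) = y" by (simp add: U_split[OF z(1)] z(2) y'_def)
    then show ?thesis by metis
  qed
  ultimately have bij_U: "bij U" by (auto simp: bij_def surj_def)
  have U_norm: "norm (U v) = norm v" for v
  proof -
    have "Re (cinner (U v) (U v)) = Re (cinner v v)" using U_inner[of v v] \<sigma> by auto
    then show ?thesis by (simp add: Re_cinner_self)
  qed
  have U_lift: "U (lift e z) = lift e' (chart_map z)" if z: "cinner z e = 0" for z
  proof -
    have "norm (chart_map z) = norm z" by (rule chart_image_norm[OF chart_image_chart_map[OF z]])
    moreover have "U (e + z) = e' + chart_map z" using U_split[OF z, of 1] \<sigma> by auto
    moreover have "\<sigma> (complex_of_real r) = complex_of_real r" for r using \<sigma> by auto
    ultimately show ?thesis by (simp only: lift_def U_scale)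
  qed
  have rays: "\<exists>c. cmod c = 1 \<and> x' = c *\<^sub>C U x" if x: "\<rho> x x'" for x x'
  proof -
    have n: "norm x = 1" "norm x' = 1" using unit[OF x] by auto
    have "cmod (cinner x' (U x)) = 1"
    proof (cases "cinner x e = 0")
      case False
      then obtain d z where d: "cmod d = 1" "cinner z e = 0" "x = d *\<^sub>C lift e z"
        using lift_exists[OF base_unit(1) n(1)] by blast
      have "\<rho> (lift e z) (U (lift e z))" using chart_image_chart_map[OF d(2)] U_lift[OF d(2)]
        by (simp add: chart_image_def)
      moreover have "cmod (\<sigma> d) = 1" using d(1) \<sigma> by auto
      ultimately have "\<rho> x (U x)"
        using phase[of "lift e z" "U (lift e z)" d "\<sigma> d"] d(1) unfolding d(3) U_scale by blast
      then show ?thesis using transition[OF x] n by (simp add: cinner_self)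
    next
      case True
      \<comment> \<open>A ray orthogonal to the base point is reached through the nearby ray of \<open>e + x\<close>.\<close>
      let ?s = "1 / sqrt (1 + (norm x)\<^sup>2)"
      have x'e': "cinner x' e' = 0" using transition[OF x base] True by simp
      have xe: "cinner x e = 0" by fact
      have "cmod (cinner x' (lift e' (chart_map x))) = cmod (cinner x (lift e x))"
        using transition[OF x] chart_image_chart_map[OF True] by (auto simp: chart_image_def)
      moreover have "cinner x (lift e x) = complex_of_real ?s"
        using n by (simp add: lift_def cinner_expand xe cinner_self)
      moreover have "cinner x' (lift e' (chart_map x)) =
        complex_of_real ?s * cinner x' (chart_map x)"
        using chart_image_norm[OF chart_image_chart_map[OF True]]
          by (simp add: lift_def cinner_expand x'e')
      ultimately have "cmod (cinner x' (chart_map x)) = 1"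
        using n by (simp add: norm_mult norm_divide)
      moreover have "U x = chart_map x" using U_split[OF True, of 0] \<sigma> by auto
      ultimately show ?thesis by simp
    qed
    then show ?thesis using unit_vectors_parallel[of x' "U x"] n U_norm by metis
  qed
  have "unitary_op U \<or> antiunitary_op U"
  proof (cases "\<sigma> = cnj")
    case True
    then show ?thesis using bij_U U_add U_scale U_inner by (simp add: antiunitary_op_def)
  next
    case False
    then have id: "\<sigma> = (\<lambda>c. c)" using \<sigma> by simp
    have "bounded_linear U"
      by (intro bounded_linear_intro[of U 1]) (simp_all add: U_add scaleR_scaleC U_scale id U_norm)
    then show ?thesis using bij_U U_scale U_inner
      by (simp add: unitary_op_def bounded_clinear_def id)
  qed
  then show ?thesis using rays by blast
qed

section \<open>From rays to all effects\<close>

context sequential_automorphism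
begin

lemma ray_image_transition:
  assumes dim: "cdim_at_least TYPE('a) 3" and x: "ray_image x x'" and y: "ray_image y y'"
  shows "cmod (cinner x' y') = cmod (cinner x y)"
proof -
  have "(cmod (cinner x' y'))\<^sup>2 = (cmod (cinner x y))\<^sup>2"
    using image_form_eq[OF dim x rank1_effect[of y]] y by (simp add: ray_image_def rank1_form)
  then show ?thesis by simp
qed

text \<open>An effect is determined by its quadratic form, so \<open>\<phi>\<close> respects convex combinations. The
  midpoint of two projections is the simplest effect in which two rays interfere.\<close>

lemma image_midpoint:
  assumes dim: "cdim_at_least TYPE('a) 3" and x: "ray_image x x'" and y: "ray_image y y'"
  shows "\<phi> (\<lambda>v. (1/2) *\<^sub>C (rank1 x v + rank1 y v)) = (\<lambda>v. (1/2) *\<^sub>C (rank1 x' v + rank1 y' v))"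
proof (rule effect_eqI)
  have R: "rank1 x \<in> effects" "rank1 y \<in> effects" "rank1 x' \<in> effects" "rank1 y' \<in> effects"
    using x y by (simp_all add: ray_image_def rank1_effect)
  note mid = midpoint_effect[OF R(1,2)]
  show "\<phi> (\<lambda>v. (1/2) *\<^sub>C (rank1 x v + rank1 y v)) \<in> effects" by (rule image_effect[OF mid])
  show "(\<lambda>v. (1/2) *\<^sub>C (rank1 x' v + rank1 y' v)) \<in> effects" by (rule midpoint_effect[OF R(3,4)])
  fix v' :: 'a
  assume "norm v' = 1"
  then obtain v where v: "ray_image v v'" using ray_preimage_exists by blast
  show "Re (cinner (\<phi> (\<lambda>v. (1/2) *\<^sub>C (rank1 x v + rank1 y v)) v') v') =
      Re (cinner ((1/2) *\<^sub>C (rank1 x' v' + rank1 y' v')) v')"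
    unfolding image_form_eq[OF dim v mid]
    by (simp add: cinner_scaleC_left cinner_add_left rank1_form
        ray_image_transition[OF dim v x] ray_image_transition[OF dim v y])
qed

text \<open>Apply the midpoint \<open>A\<close> of the projections onto \<open>x\<close> and \<open>z\<close> to \<open>y\<close>: the number \<open>\<bar>\<langle>A y, z\<rangle>\<bar>\<close>
  is the modulus of a sum of two terms, and the mixed term of its square is the cyclic product.\<close>

lemma ray_image_cycle:
  assumes dim: "cdim_at_least TYPE('a) 3"
    and x: "ray_image x x'" and y: "ray_image y y'" and z: "ray_image z z'"
  shows "Re (cinner x' y' * cinner y' z' * cinner z' x') =
    Re (cinner x y * cinner y z * cinner z x)"
proof -
  let ?A = "\<lambda>v. (1/2) *\<^sub>C (rank1 x v + rank1 z v)" and ?A' =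
    "\<lambda>v. (1/2) *\<^sub>C (rank1 x' v + rank1 z' v)"
  have R: "rank1 x \<in> effects" "rank1 z \<in> effects"
    using x z by (simp_all add: ray_image_def rank1_effect)
  have A: "?A \<in> effects" by (rule midpoint_effect[OF R])
  have "norm (?A y) \<le> 1" using effect_norm_le[OF A, of y] y by (simp add: ray_image_def)
  then have RA: "rank1 (?A y) \<in> effects" by (rule rank1_effect)
  have "\<phi> (rank1 (?A y)) = rank1 (?A' y')"
    using ray_image_conjugate_eq[OF y A] image_midpoint[OF dim x z] by simp
  then have "(cmod (cinner z' (?A' y')))\<^sup>2 = (cmod (cinner z (?A y)))\<^sup>2"
    using image_form_eq[OF dim z RA] by (simp only: rank1_form Re_complex_of_real)
  then have eq: "cmod (cinner (?A' y') z') = cmod (cinner (?A y) z)"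
    using cmod_cinner_commute[of z' "?A' y'"] cmod_cinner_commute[of z "?A y"] by simp
  have expand: "(cmod (cinner ((1/2) *\<^sub>C (rank1 a b + rank1 c b)) c))\<^sup>2 =
      ((cmod (cinner b a) * cmod (cinner a c))\<^sup>2 + (cmod (cinner b c))\<^sup>2
        + 2 * Re (cinner a b * cinner b c * cinner c a)) / 4"
    if "norm c = 1" for a b c :: 'a
  proof -
    have "cinner ((1/2) *\<^sub>C (rank1 a b + rank1 c b)) c =
        (1/2) * (cinner b a * cinner a c + cinner b c)"
      using that by (simp add: rank1_def cinner_expand cinner_self)
    moreover have "cinner a b = cnj (cinner b a)" "cinner c a = cnj (cinner a c)"
      by (rule cinner_commute)+
    ultimately show ?thesis
      by (simp only: norm_mult power_mult_distrib)
        (simp add: cmod_power2, simp add: power2_eq_square algebra_simps)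
  qed
  show ?thesis
    using expand[of z x y] expand[of z' x' y'] eq x y z ray_image_transition[OF dim y x]
      ray_image_transition[OF dim x z] ray_image_transition[OF dim y z]
    by (simp add: ray_image_def)
qed

lemma ray_correspondence_ray_image:
  assumes "cdim_at_least TYPE('a) 3"
  shows "ray_correspondence ray_image"
proof
  fix x x' y y' z z' :: 'a and c d :: complex
  show "ray_image x x' \<Longrightarrow> norm x = 1 \<and> norm x' = 1" by (simp add: ray_image_def)
  show "norm x = 1 \<Longrightarrow> \<exists>x'. ray_image x x'" by (rule ray_image_exists)
  show "norm x' = 1 \<Longrightarrow> \<exists>x. ray_image x x'" by (rule ray_preimage_exists)
  show "ray_image x x' \<Longrightarrow> cmod c = 1 \<Longrightarrow> cmod d = 1 \<Longrightarrow> ray_image (c *\<^sub>C x) (d *\<^sub>C x')"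
    by (rule ray_image_phase)
  show "ray_image x x' \<Longrightarrow> ray_image y y' \<Longrightarrow> cmod (cinner x' y') = cmod (cinner x y)"
    by (rule ray_image_transition[OF assms])
  show "ray_image x x' \<Longrightarrow> ray_image y y' \<Longrightarrow> ray_image z z' \<Longrightarrow>
      Re (cinner x' y' * cinner y' z' * cinner z' x') = Re (cinner x y * cinner y z * cinner z x)"
    by (rule ray_image_cycle[OF assms])
qed

end

theorem theorem3:
  fixes \<phi> :: "('a::complex_hilbert \<Rightarrow> 'a) \<Rightarrow> ('a \<Rightarrow> 'a)"
  assumes dim: "cdim_at_least TYPE('a) 3"
    and bij: "bij_betw \<phi> effects effects"
    and triple: "\<And>A B. A \<in> effects \<Longrightarrow> B \<in> effects \<Longrightarrow>
      \<phi> (A \<circ> B \<circ> A) = \<phi> A \<circ> \<phi> B \<circ> \<phi> A"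
  shows "\<exists>U. (unitary_op U \<and> (\<forall>A\<in>effects. \<phi> A = U \<circ> A \<circ> cadjoint U)) \<or>
    (antiunitary_op U \<and> (\<forall>A\<in>effects. \<phi> A = U \<circ> A \<circ> inv U))"
proof -
  interpret sequential_automorphism \<phi> using bij triple by unfold_locales
  interpret ray_correspondence ray_image by (rule ray_correspondence_ray_image[OF dim])
  obtain U where U: "unitary_op U \<or> antiunitary_op U"
    and rays: "\<And>x x'. ray_image x x' \<Longrightarrow> \<exists>c. cmod c = 1 \<and> x' = c *\<^sub>C U x"
    using wigner[OF exists_unit_vector[OF dim]] by blast
  have bij_U: "bij U" using U by (auto simp: unitary_op_def antiunitary_op_def)
  have U_add: "U (x + y) = U x + U y" for x y
    using U linear_simps(1)[of U x y]
      by (auto simp: unitary_op_def antiunitary_op_def bounded_clinear_def)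
  have U_real: "U (complex_of_real r *\<^sub>C x) = complex_of_real r *\<^sub>C U x" for r x
    using U by (auto simp: unitary_op_def antiunitary_op_def bounded_clinear_def)
  have U_Re: "Re (cinner (U x) (U y)) = Re (cinner x y)" for x y
    using U by (auto simp: unitary_op_def antiunitary_op_def)
  have intertwine: "\<phi> A (U x) = U (A x)" if A: "A \<in> effects" for A x
  proof -
    have A': "\<phi> A \<in> effects" by (rule image_effect[OF A])
    have form: "Re (cinner (\<phi> A (U v)) (U v)) = Re (cinner (A v) v)" for v
    proof (cases "v = 0")
      case True
      then show ?thesis using U_real[of 0 0] by (simp add: effectD(3)[OF A] effectD(3)[OF A'])
    next
      case False
      define u where "u = complex_of_real (1 / norm v) *\<^sub>C v"
      obtain u' where u': "ray_image u u'"
        using ray_image_exists[OF normalized[OF False]] unfolding u_def by blast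
      then obtain c where c: "cmod c = 1" "u' = c *\<^sub>C U u" using rays by blast
      have "cnj c * c = 1" using c(1) complex_norm_square[of c] by (simp add: mult.commute)
      then have "cinner (\<phi> A u') u' = cinner (\<phi> A (U u)) (U u)"
        by (simp add: c(2) effectD(2)[OF A'] cinner_expand flip: mult.assoc)
      then have eq: "Re (cinner (\<phi> A (U u)) (U u)) = Re (cinner (A u) u)"
        using image_form_eq[OF dim u' A] by simp
      show ?thesis
        using eq False
        unfolding u_def U_real effectD(2)[OF A] effectD(2)[OF A']
          cinner_scaleC_left cinner_scaleC_right
        by simp
    qed
    \<comment> \<open>Polarization, for the real bilinear forms \<open>Re \<langle>\<phi> A (U x), U w\<rangle>\<close> and \<open>Re \<langle>A x, w\<rangle>\<close>.\<close>
    have "Re (cinner (\<phi> A (U x)) (U w)) = Re (cinner (U (A x)) (U w))" for w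
      using form[of "x + w"] form[of x] form[of w] effectD(4)[OF A, of w x]
        effectD(4)[OF A', of "U w" "U x"] Re_cinner_commute[of w "A x"]
        Re_cinner_commute[of "U w" "\<phi> A (U x)"] U_Re[of "A x" w]
      by (simp add: U_add effectD(1)[OF A] effectD(1)[OF A'] cinner_expand)
    then show ?thesis
      using bij_U by (intro Re_cinner_eqI) (metis bij_pointE)
  qed
  have "\<phi> A = U \<circ> A \<circ> inv U" if A: "A \<in> effects" for A
    using intertwine[OF A] bij_U by (intro ext) (metis bij_inv_eq_iff comp_apply)
  then show ?thesis using U unitary_op_cadjoint by metis
qed

end
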